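(* A complete MV-algebra $A$ is algebraic (as a frame) if and only if $A$ is isomorphic to a direct product $\prod_{x\in X}\text{Ł}_{n_x}$ of finite MV-chains, for some set $X$ and integers $n_x\ge 2$.
   Context: A complete MV-algebra, viewed as a frame, is called an MV-frame. An element $a$ of a complete lattice $L$ is compact if whenever $a\le\bigvee S$ for $S\subseteq L$ there is a finite $F\subseteq S$ with $a\le\bigvee F$; $L$ is algebraic if each $a\in L$ is the join of the compact elements below it. $\text{Ł}_n=\{0,\frac1{n-1},\dots,1\}$ with $x\oplus y=\min(1,x+y)$, $\neg x=1-x$ is the $n$-element MV-chain; every finite MV-chain is isomorphic to some $\text{Ł}_n$. Products carry coordinatewise operations. *)

theory Defs
  imports Complex_Main "HOL-Library.FuncSet" "HOL-Algebra.Complete_Lattice"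
begin

section \<open>MV-algebras\<close>

record 'a mv = "'a partial_object" +
  mv_plus :: "'a \<Rightarrow> 'a \<Rightarrow> 'a" (infixl \<open>\<oplus>\<index>\<close> 65)
  mv_neg :: "'a \<Rightarrow> 'a" (\<open>\<sim>\<index>_\<close> [81] 80)
  mv_zero :: "'a" (\<open>\<zero>\<index>\<close>)

locale mv_algebra =
  fixes A (structure)
  assumes plus_closed: "\<lbrakk>x \<in> carrier A; y \<in> carrier A\<rbrakk> \<Longrightarrow> x \<oplus> y \<in> carrier A"
    and neg_closed: "x \<in> carrier A \<Longrightarrow> \<sim>x \<in> carrier A"
    and zero_closed: "\<zero> \<in> carrier A"
    and plus_assoc: "\<lbrakk>x \<in> carrier A; y \<in> carrier A; z \<in> carrier A\<rbrakk>
                      \<Longrightarrow> (x \<oplus> y) \<oplus> z = x \<oplus> (y \<oplus> z)"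
    and plus_comm: "\<lbrakk>x \<in> carrier A; y \<in> carrier A\<rbrakk> \<Longrightarrow> x \<oplus> y = y \<oplus> x"
    and plus_zero: "x \<in> carrier A \<Longrightarrow> x \<oplus> \<zero> = x"
    and neg_neg: "x \<in> carrier A \<Longrightarrow> \<sim>(\<sim>x) = x"
    and plus_one: "x \<in> carrier A \<Longrightarrow> x \<oplus> \<sim>\<zero> = \<sim>\<zero>"
    and lukasiewicz_axiom: "\<lbrakk>x \<in> carrier A; y \<in> carrier A\<rbrakk>
                      \<Longrightarrow> \<sim>(\<sim>x \<oplus> y) \<oplus> y = \<sim>(\<sim>y \<oplus> x) \<oplus> x"

text \<open>The natural order: \<open>x \<le> y\<close> iff \<open>\<not>x \<oplus> y = 1\<close>, where \<open>1 = \<not>0\<close>. A complete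
  MV-algebra is one whose natural order is a complete lattice; the frame distributive law
  then holds automatically.\<close>

definition mv_order :: "('a, 'm) mv_scheme \<Rightarrow> 'a gorder" where
  "mv_order A = \<lparr>carrier = carrier A, eq = (=),
                 le = (\<lambda>x y. \<sim>\<^bsub>A\<^esub>x \<oplus>\<^bsub>A\<^esub> y = \<sim>\<^bsub>A\<^esub>\<zero>\<^bsub>A\<^esub>)\<rparr>"

definition mv_iso :: "('a, 'm) mv_scheme \<Rightarrow> ('b, 'n) mv_scheme \<Rightarrow> ('a \<Rightarrow> 'b) set" where
  "mv_iso A B = {h. bij_betw h (carrier A) (carrier B) \<and>
     (\<forall>x\<in>carrier A. \<forall>y\<in>carrier A. h (x \<oplus>\<^bsub>A\<^esub> y) = h x \<oplus>\<^bsub>B\<^esub> h y) \<and>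
     (\<forall>x\<in>carrier A. h (\<sim>\<^bsub>A\<^esub>x) = \<sim>\<^bsub>B\<^esub>(h x)) \<and>
     h \<zero>\<^bsub>A\<^esub> = \<zero>\<^bsub>B\<^esub>}"

definition mv_isomorphic :: "('a, 'm) mv_scheme \<Rightarrow> ('b, 'n) mv_scheme \<Rightarrow> bool" where
  "mv_isomorphic A B \<longleftrightarrow> mv_iso A B \<noteq> {}"

text \<open>Meant for \<open>n \<ge> 2\<close> only.\<close>

definition mv_chain :: "nat \<Rightarrow> real mv" where
  "mv_chain n = \<lparr>carrier = {real k / real (n - 1) | k. k \<le> n - 1},
                 mv_plus = (\<lambda>x y. min 1 (x + y)),
                 mv_neg = (\<lambda>x. 1 - x),
                 mv_zero = 0\<rparr>"

definition mv_product :: "'i set \<Rightarrow> ('i \<Rightarrow> ('a, 'm) mv_scheme) \<Rightarrow> ('i \<Rightarrow> 'a) mv" where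
  "mv_product X B = \<lparr>carrier = (\<Pi>\<^sub>E i\<in>X. carrier (B i)),
                     mv_plus = (\<lambda>f g. \<lambda>i\<in>X. f i \<oplus>\<^bsub>B i\<^esub> g i),
                     mv_neg = (\<lambda>f. \<lambda>i\<in>X. \<sim>\<^bsub>B i\<^esub>(f i)),
                     mv_zero = (\<lambda>i\<in>X. \<zero>\<^bsub>B i\<^esub>)\<rparr>"

section \<open>Algebraic complete lattices\<close>

definition compact_element :: "('a, 'm) gorder_scheme \<Rightarrow> 'a \<Rightarrow> bool" where
  "compact_element L a \<longleftrightarrow> a \<in> carrier L \<and>
     (\<forall>S. S \<subseteq> carrier L \<longrightarrow> a \<sqsubseteq>\<^bsub>L\<^esub> \<Squnion>\<^bsub>L\<^esub>S \<longrightarrow>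
        (\<exists>F. finite F \<and> F \<subseteq> S \<and> a \<sqsubseteq>\<^bsub>L\<^esub> \<Squnion>\<^bsub>L\<^esub>F))"

text \<open>Used only for complete lattices \<open>L\<close> whose equality is \<open>(=)\<close>.\<close>

definition algebraic_lattice :: "('a, 'm) gorder_scheme \<Rightarrow> bool" where
  "algebraic_lattice L \<longleftrightarrow>
     (\<forall>a\<in>carrier L. a = \<Squnion>\<^bsub>L\<^esub>{c. compact_element L c \<and> c \<sqsubseteq>\<^bsub>L\<^esub> a})"

section \<open>Consistency of the definitions\<close>

lemma mv_algebra_chain:
  assumes "n \<ge> 2"
  shows "mv_algebra (mv_chain n)"
proof -
  obtain m where n: "n = Suc m" and m: "m > 0" using assms by (cases n) auto
  let ?C = "{real k / real m | k. k \<le> m}"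
  have mem: "x \<ge> 0 \<and> x \<le> 1" if "x \<in> ?C" for x
    using that m by (auto simp: divide_le_eq)
  have plus: "min 1 (x + y) \<in> ?C" if xy: "x \<in> ?C" "y \<in> ?C" for x y
  proof -
    obtain j k where jk: "x = real j / real m" "y = real k / real m" using xy by blast
    have "min 1 (x + y) = real (min m (j + k)) / real m"
      using m by (auto simp: jk min_def field_simps simp flip: of_nat_add)
    then show ?thesis by (intro CollectI exI[of _ "min m (j + k)"]) auto
  qed
  have neg: "1 - x \<in> ?C" if x: "x \<in> ?C" for x
  proof -
    obtain k where k: "x = real k / real m" "k \<le> m" using x by blast
    have "1 - x = real (m - k) / real m" using k m by (simp add: field_simps of_nat_diff)
    then show ?thesis by (intro CollectI exI[of _ "m - k"]) auto
  qed
  have zero: "0 \<in> ?C" by (intro CollectI exI[of _ 0]) auto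
  have car: "carrier (mv_chain n) = ?C" by (simp add: mv_chain_def n)
  have ops: "mv_plus (mv_chain n) = (\<lambda>x y. min 1 (x + y))"
    "mv_neg (mv_chain n) = (\<lambda>x. 1 - x)" "mv_zero (mv_chain n) = 0"
    by (simp_all add: mv_chain_def)
  show ?thesis
  proof (unfold_locales, unfold car ops, goal_cases)
    case 1 then show ?case by (rule plus)
  next
    case 2 then show ?case by (rule neg)
  next
    case 3 show ?case by (rule zero)
  next
    case (4 x y z)
    with mem[of x] mem[of y] mem[of z] show ?case by (simp add: min_def)
  next
    case 5 then show ?case by (simp add: add.commute)
  next
    case (6 x) with mem[of x] show ?case by simp
  next
    case 7 then show ?case by simp
  next
    case (8 x) with mem[of x] show ?case by simp
  next
    case (9 x y) with mem[of x] mem[of y] show ?case by (simp add: min_def)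
  qed
qed

lemma mv_algebra_product:
  assumes "\<And>i. i \<in> X \<Longrightarrow> mv_algebra (B i)"
  shows "mv_algebra (mv_product X B)"
proof -
  note ax = mv_algebra.plus_closed mv_algebra.neg_closed mv_algebra.zero_closed
    mv_algebra.plus_assoc mv_algebra.plus_zero mv_algebra.neg_neg mv_algebra.plus_one
  show ?thesis
    by unfold_locales
       (auto simp: mv_product_def PiE_iff extensional_def fun_eq_iff ax[OF assms]
             intro: mv_algebra.plus_comm[OF assms] mv_algebra.lukasiewicz_axiom[OF assms])
qed

end

(* Everything is derived from the residuation law: x - y <= z iff x <= y + z, without meets or the
   frame law. If A is algebraic, a nonzero compact c has a maximal element m strictly below it (Zorn),
   and c - m is an atom; so every nonzero element lies above an atom. By completeness the multiples
   of an atom p become stationary, at N(p) p say, and everything below N(p) p is a multiple of p.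
   The coordinate of x at p is the largest k <= N(p) with k p <= x; the coordinates are
   homomorphisms to finite chains, separate points because atoms are dense, and are realised
   independently by suprema of multiples of atoms. Conversely, in a product of finite chains
   the elements supported on a single index are compact and every element is their join. *)

theory Submission
  imports Defs
begin

section \<open>Order and truncated arithmetic in an MV-algebra\<close>

context mv_algebra
begin

abbreviation mv_le :: "'a \<Rightarrow> 'a \<Rightarrow> bool" (infix \<open>\<preceq>\<close> 50) where
  "x \<preceq> y \<equiv> x \<sqsubseteq>\<^bsub>mv_order A\<^esub> y"

text \<open>The truncated difference: in a chain of reals it is \<open>max 0 (x - y)\<close>. It is
  the residual of \<open>\<oplus>\<close>.\<close>

definition mv_diff :: "'a \<Rightarrow> 'a \<Rightarrow> 'a" (infixl \<open>\<ominus>\<close> 65) where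
  "x \<ominus> y = \<sim>(\<sim>x \<oplus> y)"

definition mv_mult :: "nat \<Rightarrow> 'a \<Rightarrow> 'a" (infixr \<open>\<cdot>\<close> 70) where
  "k \<cdot> x = ((\<oplus>) x ^^ k) \<zero>"

declare plus_closed [simp, intro] neg_closed [simp, intro] zero_closed [simp, intro]
  plus_zero [simp] neg_neg [simp] plus_one [simp]

lemma le_iff: "x \<preceq> y \<longleftrightarrow> \<sim>x \<oplus> y = \<sim>\<zero>"
  by (simp add: mv_order_def)

lemma zero_plus [simp]: "x \<in> carrier A \<Longrightarrow> \<zero> \<oplus> x = x"
  using plus_comm[of \<zero> x] by simp

lemma one_plus [simp]: "x \<in> carrier A \<Longrightarrow> \<sim>\<zero> \<oplus> x = \<sim>\<zero>"
  using plus_comm[of "\<sim>\<zero>" x] by simp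

text \<open>The Lukasiewicz axiom with \<open>y\<close> taken as the top element: one side collapses
  to the top, the other to \<open>\<sim>x \<oplus> x\<close>.\<close>

lemma neg_plus_self [simp]: "x \<in> carrier A \<Longrightarrow> \<sim>x \<oplus> x = \<sim>\<zero>"
  using lukasiewicz_axiom[of x "\<sim>\<zero>"] by simp

lemma plus_neg_self [simp]: "x \<in> carrier A \<Longrightarrow> x \<oplus> \<sim>x = \<sim>\<zero>"
  using plus_comm[of x "\<sim>x"] by simp

lemma diff_closed [simp, intro]: "\<lbrakk>x \<in> carrier A; y \<in> carrier A\<rbrakk> \<Longrightarrow> x \<ominus> y \<in> carrier A"
  by (simp add: mv_diff_def)

lemma mult_0 [simp]: "0 \<cdot> x = \<zero>"
  and mult_Suc [simp]: "Suc k \<cdot> x = x \<oplus> k \<cdot> x"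
  by (simp_all add: mv_mult_def)

lemma mult_closed [simp, intro]: "x \<in> carrier A \<Longrightarrow> k \<cdot> x \<in> carrier A"
  by (induction k) auto

lemma le_refl [simp]: "x \<in> carrier A \<Longrightarrow> x \<preceq> x"
  by (simp add: le_iff)

lemma zero_le [simp]: "x \<in> carrier A \<Longrightarrow> \<zero> \<preceq> x"
  by (simp add: le_iff)

lemma le_one [simp]: "x \<in> carrier A \<Longrightarrow> x \<preceq> \<sim>\<zero>"
  by (simp add: le_iff)

lemma le_antisym: "\<lbrakk>x \<preceq> y; y \<preceq> x; x \<in> carrier A; y \<in> carrier A\<rbrakk> \<Longrightarrow> x = y"
  using lukasiewicz_axiom[of x y] by (simp add: le_iff)

text \<open>If \<open>\<sim>x \<oplus> y\<close> is the top, one side of the Lukasiewicz axiom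
  reduces to \<open>y\<close> and the other is \<open>(y \<ominus> x) \<oplus> x\<close>. Hence the
  natural order is divisibility with respect to \<open>\<oplus>\<close>, from which transitivity and
  monotonicity follow by associativity.\<close>

lemma plus_diff: "\<lbrakk>x \<preceq> y; x \<in> carrier A; y \<in> carrier A\<rbrakk> \<Longrightarrow> x \<oplus> (y \<ominus> x) = y"
  using lukasiewicz_axiom[of x y] plus_comm[of x "y \<ominus> x"] by (simp add: le_iff mv_diff_def)

lemma le_plus1: "\<lbrakk>x \<in> carrier A; y \<in> carrier A\<rbrakk> \<Longrightarrow> x \<preceq> x \<oplus> y"
  using plus_assoc[of "\<sim>x" x y] by (simp add: le_iff)

lemma le_plus2: "\<lbrakk>x \<in> carrier A; y \<in> carrier A\<rbrakk> \<Longrightarrow> y \<preceq> x \<oplus> y"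
  using le_plus1[of y x] plus_comm[of x y] by simp

lemma le_trans:
  assumes "x \<preceq> y" "y \<preceq> z" "x \<in> carrier A" "y \<in> carrier A" "z \<in> carrier A"
  shows "x \<preceq> z"
proof -
  have "z = x \<oplus> ((y \<ominus> x) \<oplus> (z \<ominus> y))"
    using assms plus_diff[of x y] plus_diff[of y z] plus_assoc[of x "y \<ominus> x" "z \<ominus> y"] by simp
  then show ?thesis using assms le_plus1[of x "(y \<ominus> x) \<oplus> (z \<ominus> y)"] by simp
qed

lemma plus_mono_left:
  assumes "x \<preceq> y" "x \<in> carrier A" "y \<in> carrier A" "z \<in> carrier A"
  shows "z \<oplus> x \<preceq> z \<oplus> y"
proof -
  have "z \<oplus> y = (z \<oplus> x) \<oplus> (y \<ominus> x)"
    using assms plus_diff[of x y] plus_assoc[of z x "y \<ominus> x"] by simp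
  then show ?thesis using assms le_plus1[of "z \<oplus> x" "y \<ominus> x"] by simp
qed

lemma plus_mono:
  assumes "x \<preceq> y" "u \<preceq> v" "x \<in> carrier A" "y \<in> carrier A" "u \<in> carrier A" "v \<in> carrier A"
  shows "x \<oplus> u \<preceq> y \<oplus> v"
proof -
  have "x \<oplus> u \<preceq> x \<oplus> v" using assms by (simp add: plus_mono_left)
  moreover have "x \<oplus> v \<preceq> y \<oplus> v"
    using assms plus_mono_left[of x y v] plus_comm[of x v] plus_comm[of y v] by simp
  ultimately show ?thesis using assms by (meson le_trans plus_closed)
qed

lemma neg_le_swap: "\<lbrakk>x \<in> carrier A; y \<in> carrier A\<rbrakk> \<Longrightarrow> x \<preceq> \<sim>y \<longleftrightarrow> y \<preceq> \<sim>x"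
  using plus_comm[of "\<sim>x" "\<sim>y"] by (simp add: le_iff)

lemma neg_mono: "\<lbrakk>x \<preceq> y; x \<in> carrier A; y \<in> carrier A\<rbrakk> \<Longrightarrow> \<sim>y \<preceq> \<sim>x"
  using neg_le_swap[of "\<sim>y" x] by simp

text \<open>Residuation is associativity in disguise: both sides say that
  \<open>\<sim>x \<oplus> y \<oplus> z\<close> is the top.\<close>

lemma diff_le_iff:
  "\<lbrakk>x \<in> carrier A; y \<in> carrier A; z \<in> carrier A\<rbrakk> \<Longrightarrow> x \<ominus> y \<preceq> z \<longleftrightarrow> x \<preceq> y \<oplus> z"
  by (simp add: le_iff mv_diff_def plus_assoc)

lemma diff_le: "\<lbrakk>x \<in> carrier A; y \<in> carrier A\<rbrakk> \<Longrightarrow> x \<ominus> y \<preceq> x"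
  by (simp add: diff_le_iff le_plus2)

lemma le_plus_diff: "\<lbrakk>x \<in> carrier A; y \<in> carrier A\<rbrakk> \<Longrightarrow> x \<preceq> y \<oplus> (x \<ominus> y)"
  using diff_le_iff[of x y "x \<ominus> y"] by simp

lemma diff_le_neg: "\<lbrakk>x \<in> carrier A; y \<in> carrier A\<rbrakk> \<Longrightarrow> x \<ominus> y \<preceq> \<sim>y"
  by (simp add: diff_le_iff)

lemma le_zero_iff: "x \<in> carrier A \<Longrightarrow> x \<preceq> \<zero> \<longleftrightarrow> x = \<zero>"
  using le_antisym[of x \<zero>] by auto

lemma diff_eq_zero_iff: "\<lbrakk>x \<in> carrier A; y \<in> carrier A\<rbrakk> \<Longrightarrow> x \<ominus> y = \<zero> \<longleftrightarrow> x \<preceq> y"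
  using diff_le_iff[of x y \<zero>] by (simp add: le_zero_iff)

lemma diff_antimono:
  assumes "y \<preceq> z" "x \<in> carrier A" "y \<in> carrier A" "z \<in> carrier A"
  shows "x \<ominus> z \<preceq> x \<ominus> y"
proof -
  have "x \<preceq> y \<oplus> (x \<ominus> y)" using assms by (simp add: le_plus_diff)
  moreover have "y \<oplus> (x \<ominus> y) \<preceq> z \<oplus> (x \<ominus> y)" using assms by (simp add: plus_mono)
  ultimately have "x \<preceq> z \<oplus> (x \<ominus> y)" using assms by (meson le_trans plus_closed diff_closed)
  then show ?thesis using assms by (simp add: diff_le_iff)
qed

text \<open>The hypothesis says that the sum \<open>x \<oplus> y\<close> is not truncated. The proof
  dualises: \<open>\<sim>x \<ominus> y\<close> is \<open>\<sim>(x \<oplus> y)\<close>, so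
  \<open>plus_diff\<close> applied to \<open>y \<preceq> \<sim>x\<close> is the claim after
  negation.\<close>

lemma plus_diff_cancel:
  assumes "x \<preceq> \<sim>y" "x \<in> carrier A" "y \<in> carrier A"
  shows "(x \<oplus> y) \<ominus> y = x"
proof -
  have "y \<preceq> \<sim>x" using assms neg_le_swap by blast
  then have "y \<oplus> (\<sim>x \<ominus> y) = \<sim>x" using assms by (simp add: plus_diff)
  then have "(\<sim>(x \<oplus> y)) \<oplus> y = \<sim>x"
    using assms plus_comm[of y "\<sim>x \<ominus> y"] by (simp add: mv_diff_def)
  then show ?thesis using assms by (simp add: mv_diff_def)
qed

lemma mult_add: "x \<in> carrier A \<Longrightarrow> (j + k) \<cdot> x = j \<cdot> x \<oplus> k \<cdot> x"
  by (induction j) (simp_all add: plus_assoc)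

lemma mult_mono:
  assumes "j \<le> k" "x \<in> carrier A"
  shows "j \<cdot> x \<preceq> k \<cdot> x"
  using assms mult_add[of x j "k - j"] le_plus1[of "j \<cdot> x" "(k - j) \<cdot> x"] by simp

lemma diff_mono:
  assumes "x \<preceq> y" "x \<in> carrier A" "y \<in> carrier A" "z \<in> carrier A"
  shows "x \<ominus> z \<preceq> y \<ominus> z"
proof -
  have "x \<preceq> z \<oplus> (y \<ominus> z)" using assms le_trans[OF assms(1) le_plus_diff[of y z]] by simp
  then show ?thesis using assms by (simp add: diff_le_iff)
qed

section \<open>Atoms and their multiples\<close>

definition mv_atom :: "'a \<Rightarrow> bool" where
  "mv_atom p \<longleftrightarrow> p \<in> carrier A \<and> p \<noteq> \<zero> \<and> (\<forall>y\<in>carrier A. y \<preceq> p \<longrightarrow> y = \<zero> \<or> y = p)"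

lemma atom_closed [simp, intro]: "mv_atom p \<Longrightarrow> p \<in> carrier A"
  by (simp add: mv_atom_def)

lemma atom_nonzero: "mv_atom p \<Longrightarrow> p \<noteq> \<zero>"
  unfolding mv_atom_def by blast

lemma atomD: "\<lbrakk>mv_atom p; y \<preceq> p; y \<in> carrier A\<rbrakk> \<Longrightarrow> y = \<zero> \<or> y = p"
  unfolding mv_atom_def by blast

text \<open>One copy of \<open>p\<close> is peeled off at a time:
  \<open>y \<ominus> k \<cdot> p\<close> lies below the atom \<open>p\<close>, and it cannot equal
  \<open>p\<close> because it also lies below \<open>y\<close>.\<close>

lemma atom_disjoint_mult:
  assumes p: "mv_atom p" and y: "y \<in> carrier A" and np: "\<not> p \<preceq> y" and "y \<preceq> k \<cdot> p"
  shows "y = \<zero>"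
  using \<open>y \<preceq> k \<cdot> p\<close>
proof (induction k)
  case 0
  then show ?case using y by (simp add: le_zero_iff)
next
  case (Suc k)
  let ?d = "y \<ominus> k \<cdot> p"
  have pc: "p \<in> carrier A" "k \<cdot> p \<in> carrier A" using p by auto
  have "y \<preceq> k \<cdot> p \<oplus> p" using Suc.prems plus_comm[OF pc] by simp
  then have "?d \<preceq> p" using diff_le_iff[OF y pc(2,1)] by blast
  moreover have "?d \<noteq> p" using diff_le[OF y pc(2)] np by metis
  ultimately have "?d = \<zero>" using atomD[OF p] y pc by blast
  then have "y \<preceq> k \<cdot> p" using diff_eq_zero_iff[OF y pc(2)] by blast
  then show ?case by (rule Suc.IH)
qed

text \<open>As long as the multiples still grow, adding \<open>p\<close> is not truncated: the
  increment is a nonzero element below \<open>p\<close>, hence \<open>p\<close> itself, and a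
  difference by \<open>k \<cdot> p\<close> always lies below
  \<open>\<sim>(k \<cdot> p)\<close>.\<close>

lemma mult_le_neg_atom:
  assumes p: "mv_atom p" and "p \<oplus> k \<cdot> p \<noteq> k \<cdot> p"
  shows "k \<cdot> p \<preceq> \<sim>p"
proof -
  let ?d = "(p \<oplus> k \<cdot> p) \<ominus> k \<cdot> p"
  have "?d \<preceq> p" using p plus_comm[of p "k \<cdot> p"] by (simp add: diff_le_iff)
  moreover have "?d \<noteq> \<zero>"
    using assms le_plus2[of p "k \<cdot> p"] le_antisym[of "p \<oplus> k \<cdot> p" "k \<cdot> p"]
    by (auto simp: diff_eq_zero_iff)
  ultimately have "?d = p" using atomD[OF p] p by blast
  then have "p \<preceq> \<sim>(k \<cdot> p)" using diff_le_neg[of "p \<oplus> k \<cdot> p" "k \<cdot> p"] p by simp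
  then show ?thesis using p by (simp add: neg_le_swap)
qed

text \<open>The index at which the multiples of \<open>p\<close> become stationary. It is meaningful
  once such an index is known to exist, which is where completeness enters. For the atom
  \<open>1 / (n - 1)\<close> of the \<open>n\<close>-element chain it is
  \<open>n - 1\<close>.\<close>

definition atom_order :: "'a \<Rightarrow> nat" where
  "atom_order p = (LEAST k. p \<oplus> k \<cdot> p = k \<cdot> p)"

text \<open>The bound by \<open>atom_order p\<close> makes the set finite; for \<open>x\<close> in
  the carrier it contains 0, so the maximum is attained.\<close>

definition coord :: "'a \<Rightarrow> 'a \<Rightarrow> nat" where
  "coord p x = Max {k. k \<le> atom_order p \<and> k \<cdot> p \<preceq> x}"

end

section \<open>Complete MV-algebras: atoms have finite order\<close>

locale complete_mv = mv_algebra A + lat: complete_lattice "mv_order A" for A (structure)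
begin

lemma carrier_mv_order [simp]: "carrier (mv_order A) = carrier A"
  by (simp add: mv_order_def)

abbreviation mv_Sup :: "'a set \<Rightarrow> 'a" where
  "mv_Sup S \<equiv> \<Squnion>\<^bsub>mv_order A\<^esub>S"

lemma Sup_closed [simp, intro]: "S \<subseteq> carrier A \<Longrightarrow> mv_Sup S \<in> carrier A"
  using lat.sup_closed[of S] by simp

lemma Sup_upper: "\<lbrakk>S \<subseteq> carrier A; x \<in> S\<rbrakk> \<Longrightarrow> x \<preceq> mv_Sup S"
  using lat.sup_upper[of S x] by simp

lemma Sup_least: "\<lbrakk>S \<subseteq> carrier A; z \<in> carrier A; \<And>x. x \<in> S \<Longrightarrow> x \<preceq> z\<rbrakk> \<Longrightarrow> mv_Sup S \<preceq> z"
  using lat.sup_least[of S z] by simp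

text \<open>An Archimedean argument: if the multiples never stop growing, their supremum
  \<open>e\<close> lies below \<open>\<sim>p\<close>, and shifting the index shows that
  \<open>e \<ominus> p\<close> is again an upper bound. Then adding \<open>p\<close> to
  \<open>e\<close> changes nothing, although the sum is not truncated, so \<open>p\<close> would be
  zero.\<close>

lemma atom_finite_order:
  assumes p: "mv_atom p"
  shows "\<exists>k. p \<oplus> k \<cdot> p = k \<cdot> p"
proof (rule ccontr)
  assume neq: "\<not> ?thesis"
  let ?S = "range (\<lambda>k. k \<cdot> p)"
  define e where "e = mv_Sup ?S"
  have S: "?S \<subseteq> carrier A" and e: "e \<in> carrier A"
    using p by (auto simp: e_def intro!: Sup_closed)
  have below: "k \<cdot> p \<preceq> \<sim>p" for k
    using neq mult_le_neg_atom[OF p] by blast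
  have "e \<preceq> \<sim>p"
    unfolding e_def using S below p by (intro Sup_least) auto
  have "k \<cdot> p \<preceq> e \<ominus> p" for k
  proof -
    have "Suc k \<cdot> p \<preceq> e"
      unfolding e_def by (rule Sup_upper[OF S]) blast
    then have "(k \<cdot> p \<oplus> p) \<ominus> p \<preceq> e \<ominus> p"
      using p e plus_comm[of p "k \<cdot> p"] by (simp add: diff_mono)
    then show ?thesis using below p plus_diff_cancel by simp
  qed
  then have "e \<preceq> e \<ominus> p"
    unfolding e_def[symmetric] using S p e by (subst e_def, intro Sup_least) auto
  then have "p \<oplus> e \<preceq> p \<oplus> (e \<ominus> p)" using p e by (simp add: plus_mono_left)
  moreover have "p \<preceq> e"
    unfolding e_def using Sup_upper[OF S rangeI[of _ 1]] p by simp
  ultimately have "p \<oplus> e \<preceq> e" using p e by (simp add: plus_diff)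
  then have "(p \<oplus> e) \<ominus> e = \<zero>" using p e by (simp add: diff_eq_zero_iff)
  moreover have "(p \<oplus> e) \<ominus> e = p"
    using \<open>e \<preceq> \<sim>p\<close> p e by (intro plus_diff_cancel) (auto simp: neg_le_swap)
  ultimately show False using atom_nonzero[OF p] by simp
qed

lemma mult_atom_order_Suc: "mv_atom p \<Longrightarrow> p \<oplus> atom_order p \<cdot> p = atom_order p \<cdot> p"
  unfolding atom_order_def by (rule LeastI_ex[OF atom_finite_order])

lemma mult_eq_min:
  assumes p: "mv_atom p"
  shows "k \<cdot> p = min (atom_order p) k \<cdot> p"
proof (cases "k \<le> atom_order p")
  case False
  have "(atom_order p + j) \<cdot> p = atom_order p \<cdot> p" for j
    by (induction j) (simp_all add: mult_atom_order_Suc[OF p])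
  from this[of "k - atom_order p"] show ?thesis using False by simp
qed (simp add: min_absorb2)

lemma atom_order_pos: "mv_atom p \<Longrightarrow> 0 < atom_order p"
  using mult_atom_order_Suc[of p] atom_nonzero[of p] by (cases "atom_order p") auto

lemma mult_atom_le_iff:
  assumes p: "mv_atom p"
  shows "j \<cdot> p \<preceq> k \<cdot> p \<longleftrightarrow> min (atom_order p) j \<le> k"
proof
  assume le: "j \<cdot> p \<preceq> k \<cdot> p"
  show "min (atom_order p) j \<le> k"
  proof (rule ccontr)
    assume "\<not> ?thesis"
    then have "k < atom_order p" "Suc k \<le> j" by auto
    have "Suc k \<cdot> p \<preceq> k \<cdot> p"
      using mult_mono[OF \<open>Suc k \<le> j\<close>, of p] le p by (meson le_trans mult_closed atom_closed)
    then have "p \<oplus> k \<cdot> p = k \<cdot> p"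
      using p le_plus2[of p "k \<cdot> p"] le_antisym[of "p \<oplus> k \<cdot> p" "k \<cdot> p"] by simp
    then have "atom_order p \<le> k" unfolding atom_order_def by (rule Least_le)
    with \<open>k < atom_order p\<close> show False by simp
  qed
next
  assume "min (atom_order p) j \<le> k"
  then show "j \<cdot> p \<preceq> k \<cdot> p"
    using mult_mono[of "min (atom_order p) j" k p] p mult_eq_min[OF p, of j] by simp
qed

section \<open>Coordinates at an atom\<close>

lemma
  assumes p: "mv_atom p" and x: "x \<in> carrier A"
  shows coord_le: "coord p x \<le> atom_order p"
    and coord_mult_le: "coord p x \<cdot> p \<preceq> x"
    and le_coord_iff: "k \<le> atom_order p \<Longrightarrow> k \<le> coord p x \<longleftrightarrow> k \<cdot> p \<preceq> x"
proof -
  let ?K = "{k. k \<le> atom_order p \<and> k \<cdot> p \<preceq> x}"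
  have K: "finite ?K" "0 \<in> ?K" using x by auto
  then have "coord p x \<in> ?K" unfolding coord_def by (intro Max_in) auto
  then show le: "coord p x \<le> atom_order p" "coord p x \<cdot> p \<preceq> x" by auto
  show "k \<le> coord p x \<longleftrightarrow> k \<cdot> p \<preceq> x" if "k \<le> atom_order p"
  proof
    assume "k \<le> coord p x"
    then show "k \<cdot> p \<preceq> x"
      using le(2) p x mult_mono[of k "coord p x" p] by (meson le_trans mult_closed atom_closed)
  next
    assume "k \<cdot> p \<preceq> x"
    then show "k \<le> coord p x" unfolding coord_def using K that by (intro Max_ge) auto
  qed
qed

lemma mult_le_imp_min_le_coord:
  assumes p: "mv_atom p" and x: "x \<in> carrier A" and "k \<cdot> p \<preceq> x"
  shows "min (atom_order p) k \<le> coord p x"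
  using assms mult_eq_min[OF p, of k] by (simp add: le_coord_iff)

lemma coord_mult: "mv_atom p \<Longrightarrow> coord p (k \<cdot> p) = min (atom_order p) k"
proof (rule antisym)
  assume p: "mv_atom p"
  then have "coord p (k \<cdot> p) \<le> k"
    using coord_mult_le[OF p, of "k \<cdot> p"] coord_le[OF p, of "k \<cdot> p"]
    by (simp add: mult_atom_le_iff min_absorb2)
  then show "coord p (k \<cdot> p) \<le> min (atom_order p) k" using coord_le[OF p, of "k \<cdot> p"] p by simp
  show "min (atom_order p) k \<le> coord p (k \<cdot> p)"
    using p by (intro mult_le_imp_min_le_coord) auto
qed

text \<open>After subtracting the largest multiple of \<open>p\<close> below \<open>y\<close>, a
  remainder above \<open>p\<close> would allow one more copy, which is possible only if the
  coordinate is already \<open>atom_order p\<close>. A remainder not above \<open>p\<close> vanishes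
  by \<open>atom_disjoint_mult\<close>.\<close>

lemma below_mult_atom:
  assumes p: "mv_atom p" and y: "y \<in> carrier A" and le: "y \<preceq> k \<cdot> p"
  shows "y = coord p y \<cdot> p"
proof -
  let ?c = "coord p y"
  let ?d = "y \<ominus> ?c \<cdot> p"
  have cy: "?c \<cdot> p \<preceq> y" and cN: "?c \<le> atom_order p"
    using p y by (simp_all add: coord_mult_le coord_le)
  have "?d = \<zero>"
  proof (cases "p \<preceq> ?d")
    case True
    then have "?c \<cdot> p \<oplus> p \<preceq> y"
      using plus_mono_left[OF True, of "?c \<cdot> p"] plus_diff[OF cy] p y by simp
    then have "Suc ?c \<cdot> p \<preceq> y" using p plus_comm[of p "?c \<cdot> p"] by simp
    then have "min (atom_order p) (Suc ?c) \<le> ?c" using p y mult_le_imp_min_le_coord by blast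
    then have "?c = atom_order p" using cN by simp
    then have "k \<cdot> p \<preceq> ?c \<cdot> p" using p by (simp add: mult_atom_le_iff)
    then have "y \<preceq> ?c \<cdot> p" using le p y by (meson le_trans mult_closed atom_closed)
    then show ?thesis using p y by (simp add: diff_eq_zero_iff)
  next
    case False
    have "?d \<preceq> k \<cdot> p" using le p y diff_le[of y "?c \<cdot> p"]
      by (meson le_trans mult_closed atom_closed diff_closed)
    then show ?thesis using atom_disjoint_mult[OF p _ False] p y by blast
  qed
  then have "y \<preceq> ?c \<cdot> p" using p y by (simp add: diff_eq_zero_iff)
  then show ?thesis using cy p y by (simp add: le_antisym)
qed

text \<open>The upper bound is a Riesz decomposition: a multiple of \<open>p\<close> below
  \<open>x \<oplus> y\<close> is covered by a part below \<open>x\<close> and a part below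
  \<open>y\<close>, and both parts are themselves multiples of \<open>p\<close>.\<close>

lemma coord_plus:
  assumes p: "mv_atom p" and x: "x \<in> carrier A" and y: "y \<in> carrier A"
  shows "coord p (x \<oplus> y) = min (atom_order p) (coord p x + coord p y)"
proof (rule antisym)
  let ?j = "coord p (x \<oplus> y)"
  \<comment> \<open>\<open>?u\<close> is what \<open>x\<close> leaves uncovered, so residuation puts
    it below \<open>y\<close>; \<open>?v\<close> is what \<open>?u\<close> leaves uncovered, so it
    lies below \<open>x\<close>.\<close>
  let ?u = "?j \<cdot> p \<ominus> x"
  let ?v = "?j \<cdot> p \<ominus> ?u"
  have xy: "x \<oplus> y \<in> carrier A" and u: "?u \<in> carrier A" and v: "?v \<in> carrier A"
    using p x y by auto
  have uy: "?u \<preceq> y" using coord_mult_le[OF p xy] p x y by (simp add: diff_le_iff)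
  have "?j \<cdot> p \<preceq> ?u \<oplus> x"
    using le_plus_diff[of "?j \<cdot> p" x] plus_comm[of x ?u] p x by simp
  then have vx: "?v \<preceq> x" using p x by (simp add: diff_le_iff)
  have ueq: "?u = coord p ?u \<cdot> p" using p x by (intro below_mult_atom[OF p u diff_le]) auto
  have veq: "?v = coord p ?v \<cdot> p" using p x by (intro below_mult_atom[OF p v diff_le]) auto
  have "coord p ?u \<cdot> p \<preceq> y" "coord p ?v \<cdot> p \<preceq> x"
    using uy vx unfolding ueq[symmetric] veq[symmetric] .
  then have "coord p ?u \<le> coord p y" "coord p ?v \<le> coord p x"
    using le_coord_iff[OF p y coord_le[OF p u]] le_coord_iff[OF p x coord_le[OF p v]] by blast+
  moreover have "(coord p ?u + coord p ?v) \<cdot> p = ?u \<oplus> ?v"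
    using p unfolding mult_add[OF atom_closed[OF p]] ueq[symmetric] veq[symmetric] by simp
  then have "?j \<cdot> p \<preceq> (coord p ?u + coord p ?v) \<cdot> p"
    using le_plus_diff[of "?j \<cdot> p" ?u] p u by simp
  then have "?j \<le> coord p ?u + coord p ?v"
    using coord_le[OF p xy] p by (simp add: mult_atom_le_iff)
  ultimately show "?j \<le> min (atom_order p) (coord p x + coord p y)"
    using coord_le[OF p xy] by simp
next
  have "(coord p x + coord p y) \<cdot> p \<preceq> x \<oplus> y"
    using p x y by (simp add: mult_add plus_mono coord_mult_le)
  then show "min (atom_order p) (coord p x + coord p y) \<le> coord p (x \<oplus> y)"
    using p x y by (intro mult_le_imp_min_le_coord) auto
qed

lemma coord_one: "mv_atom p \<Longrightarrow> coord p (\<sim>\<zero>) = atom_order p"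
  using le_coord_iff[of p "\<sim>\<zero>" "atom_order p"] coord_le[of p "\<sim>\<zero>"] by simp

lemma coord_zero: "mv_atom p \<Longrightarrow> coord p \<zero> = 0"
  using coord_mult[of p 0] by simp

text \<open>Additivity applied to \<open>x \<oplus> \<sim>x\<close> gives one inequality. For the
  other, the multiples of \<open>p\<close> below \<open>x\<close> and below \<open>\<sim>x\<close>
  add up without truncation, so cancellation applies.\<close>

lemma coord_neg:
  assumes p: "mv_atom p" and x: "x \<in> carrier A"
  shows "coord p (\<sim>x) = atom_order p - coord p x"
proof -
  let ?N = "atom_order p" and ?k = "coord p x" and ?l = "coord p (\<sim>x)"
  have kN: "?k \<le> ?N" and lN: "?l \<le> ?N" using p x by (simp_all add: coord_le)
  have sum: "?N \<le> ?k + ?l" using coord_plus[OF p x, of "\<sim>x"] x p by (simp add: coord_one)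
  have "?l \<cdot> p \<preceq> \<sim>x" "\<sim>x \<preceq> \<sim>(?k \<cdot> p)" using p x by (simp_all add: coord_mult_le neg_mono)
  then have "?l \<cdot> p \<preceq> \<sim>(?k \<cdot> p)"
    using p x by (meson le_trans neg_closed mult_closed atom_closed)
  then have "?l \<cdot> p = (?l \<cdot> p \<oplus> ?k \<cdot> p) \<ominus> ?k \<cdot> p"
    using p by (simp add: plus_diff_cancel)
  \<comment> \<open>Both sides are the stationary multiple \<open>?N \<cdot> p\<close>, since
    \<open>?l + ?k\<close> is at least \<open>?N\<close>.\<close>
  also have "?l \<cdot> p \<oplus> ?k \<cdot> p = ?k \<cdot> p \<oplus> (?N - ?k) \<cdot> p"
    using p mult_eq_min[OF p, of "?l + ?k"] sum kN by (simp flip: mult_add)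
  finally have "?l \<cdot> p \<preceq> (?N - ?k) \<cdot> p" using p by (simp add: diff_le_iff)
  then have "?l \<le> ?N - ?k" using lN p by (simp add: mult_atom_le_iff)
  with sum show ?thesis by simp
qed

lemma coord_mult_other_atom:
  assumes p: "mv_atom p" and q: "mv_atom q" and "p \<noteq> q"
  shows "coord q (k \<cdot> p) = 0"
proof -
  have "\<not> q \<preceq> p" using atomD[OF p, of q] atom_nonzero[OF q] assms by auto
  then have "coord q p = 0"
    using le_coord_iff[OF q, of p 1] atom_order_pos[OF q] p q by simp
  then show ?thesis
    by (induction k) (use p q in \<open>simp_all add: coord_zero coord_plus\<close>)
qed

section \<open>Atoms from compact elements\<close>

text \<open>Compactness of \<open>c\<close> is what makes Zorn's lemma applicable to the elements
  strictly below \<open>c\<close>: were the supremum of a chain equal to \<open>c\<close>, finitely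
  many members of the chain would already join to \<open>c\<close>, yet they have a common bound
  strictly below it.\<close>

lemma atom_exists_below:
  assumes alg: "algebraic_lattice (mv_order A)" and a: "a \<in> carrier A" "a \<noteq> \<zero>"
  shows "\<exists>p. mv_atom p \<and> p \<preceq> a"
proof -
  have "\<exists>c. compact_element (mv_order A) c \<and> c \<preceq> a \<and> c \<noteq> \<zero>"
  proof (rule ccontr)
    let ?C = "{c. compact_element (mv_order A) c \<and> c \<preceq> a}"
    assume "\<not> ?thesis"
    then have "\<And>c. c \<in> ?C \<Longrightarrow> c \<preceq> \<zero>" by auto
    then have "mv_Sup ?C \<preceq> \<zero>" by (intro Sup_least) (auto simp: compact_element_def)
    moreover have "a = mv_Sup ?C" using alg a(1) by (simp add: algebraic_lattice_def)
    ultimately show False using a by (simp add: le_zero_iff)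
  qed
  then obtain c where cpt: "compact_element (mv_order A) c" and ca: "c \<preceq> a" and c0: "c \<noteq> \<zero>"
    by blast
  have c: "c \<in> carrier A" using cpt by (simp add: compact_element_def)
  define S where "S = {x \<in> carrier A. x \<preceq> c \<and> x \<noteq> c}"
  have "\<exists>m\<in>S. \<forall>x\<in>S. m \<preceq> x \<longrightarrow> x = m"
  proof (rule predicate_Zorn)
    show "partial_order_on S (relation_of (\<preceq>) S)"
      by (rule partial_order_on_relation_ofI)
         (auto simp: S_def intro: le_trans le_antisym)
  next
    fix C assume "C \<in> Chains (relation_of (\<preceq>) S)"
    then have CS: "C \<subseteq> S" and total: "\<And>x y. \<lbrakk>x \<in> C; y \<in> C\<rbrakk> \<Longrightarrow> x \<preceq> y \<or> y \<preceq> x"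
      by (auto simp: Chains_def relation_of_def)
    have CA: "C \<subseteq> carrier A" using CS by (auto simp: S_def)
    have fin: "\<exists>u\<in>S. \<forall>f\<in>F. f \<preceq> u" if "finite F" "F \<subseteq> C" for F
    proof -
      \<comment> \<open>Inserting \<open>\<zero>\<close> supplies a bound for empty
        \<open>F\<close>, also when the chain itself is empty; it belongs to \<open>S\<close>
        because \<open>c\<close> is nonzero.\<close>
      have "\<exists>u\<in>insert \<zero> C. \<forall>f\<in>F. f \<preceq> u"
        using that
      proof induction
        case (insert f F)
        then obtain u where u: "u \<in> insert \<zero> C" "\<forall>f\<in>F. f \<preceq> u" by auto
        have f: "f \<in> C" "f \<in> carrier A" using insert.prems CA by auto
        show ?case
        proof (cases "u \<preceq> f")
          case True
          have "g \<preceq> f" if "g \<in> F" for g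
          proof (rule le_trans[OF _ True])
            show "g \<preceq> u" "g \<in> carrier A" "u \<in> carrier A"
              using that u insert.prems CA by auto
          qed (rule f)
          then show ?thesis using f by (intro bexI[of _ f]) auto
        next
          case False
          moreover have "\<zero> \<preceq> f" using f by simp
          ultimately have "u \<in> C" using u(1) by blast
          then have "f \<preceq> u" using total[OF f(1)] False by blast
          then show ?thesis using u by blast
        qed
      qed auto
      moreover have "insert \<zero> C \<subseteq> S" using CS c c0 by (auto simp: S_def)
      ultimately show ?thesis by blast
    qed
    have "x \<preceq> c" if "x \<in> C" for x using that CS by (auto simp: S_def)
    then have "mv_Sup C \<preceq> c" by (rule Sup_least[OF CA c])
    moreover have "mv_Sup C \<noteq> c"
    proof
      assume "mv_Sup C = c"
      then have "c \<preceq> mv_Sup C" using c by simp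
      then obtain F where F: "finite F" "F \<subseteq> C" "c \<preceq> mv_Sup F"
        using cpt CA unfolding compact_element_def carrier_mv_order by blast
      from fin[OF F(1,2)] obtain u where u: "u \<in> S" "\<forall>f\<in>F. f \<preceq> u" by blast
      have FA: "F \<subseteq> carrier A" using F CA by blast
      have uA: "u \<in> carrier A" "u \<preceq> c" "u \<noteq> c" using u(1) by (auto simp: S_def)
      have "mv_Sup F \<preceq> u" using u(2) FA uA(1) by (intro Sup_least) blast+
      then have "c \<preceq> u" by (rule le_trans[OF F(3) _ c Sup_closed[OF FA] uA(1)])
      then show False using uA le_antisym[OF _ uA(2) c uA(1)] by simp
    qed
    ultimately show "\<exists>u\<in>S. \<forall>x\<in>C. x \<preceq> u"
      using Sup_upper[OF CA] Sup_closed[OF CA]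
      by (intro bexI[of _ "mv_Sup C"]) (simp_all add: S_def)
  qed
  then obtain m where m: "m \<in> carrier A" "m \<preceq> c" "m \<noteq> c"
    and maxi: "\<And>x. \<lbrakk>x \<in> carrier A; x \<preceq> c; x \<noteq> c; m \<preceq> x\<rbrakk> \<Longrightarrow> x = m"
    by (auto simp: S_def)
  let ?p = "c \<ominus> m"
  have p: "?p \<in> carrier A" using c m by simp
  have "?p \<noteq> \<zero>" using m c le_antisym[of c m] by (auto simp: diff_eq_zero_iff)
  moreover have "y = \<zero> \<or> y = ?p" if y: "y \<in> carrier A" "y \<preceq> ?p" for y
  \<comment> \<open>By maximality of \<open>m\<close>, the element \<open>m \<oplus> y\<close>,
    which lies between \<open>m\<close> and \<open>c\<close>, is one of the two.\<close>
  proof (cases "m \<oplus> y = c")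
    case True
    then have "?p \<preceq> y" using c m y by (simp add: diff_le_iff)
    then show ?thesis using y p by (simp add: le_antisym)
  next
    case False
    have "m \<oplus> y \<preceq> c" using plus_mono_left[OF y(2), of m] y p m c by (simp add: plus_diff)
    then have "m \<oplus> y = m" using maxi[of "m \<oplus> y"] False m y by (simp add: le_plus1)
    then have "y \<oplus> m = m" using plus_comm[of y m] m y by simp
    \<comment> \<open>Hence \<open>m \<oplus> y\<close> is not truncated, and
      \<open>m \<oplus> y = m\<close> forces \<open>y\<close> to be zero.\<close>
    moreover have "y \<preceq> \<sim>m" using y p m c diff_le_neg[of c m] by (meson le_trans neg_closed)
    ultimately have "y = m \<ominus> m" using plus_diff_cancel[of y m] y m by simp
    then show ?thesis using m diff_eq_zero_iff[of m m] by simp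
  qed
  ultimately have "mv_atom ?p" using p unfolding mv_atom_def by blast
  moreover have "?p \<preceq> a" using diff_le[of c m] ca a c m p by (meson le_trans)
  ultimately show ?thesis by blast
qed

section \<open>Coordinates separate points and are realised independently\<close>

text \<open>An atom \<open>p\<close> below \<open>x \<ominus> y\<close> could be added once more to
  the largest multiple of \<open>p\<close> below \<open>x\<close>, so the coordinate of
  \<open>x\<close>, and with it that of \<open>y\<close>, is full. Then \<open>\<sim>y\<close> has
  coordinate 0 at \<open>p\<close>, although \<open>p\<close> lies below
  \<open>x \<ominus> y\<close> and hence below \<open>\<sim>y\<close>.\<close>

lemma le_if_coord_le:
  assumes dense: "\<And>a. \<lbrakk>a \<in> carrier A; a \<noteq> \<zero>\<rbrakk> \<Longrightarrow> \<exists>p. mv_atom p \<and> p \<preceq> a"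
    and x: "x \<in> carrier A" and y: "y \<in> carrier A"
    and le: "\<And>p. mv_atom p \<Longrightarrow> coord p x \<le> coord p y"
  shows "x \<preceq> y"
proof (rule ccontr)
  assume "\<not> x \<preceq> y"
  then obtain p where p: "mv_atom p" "p \<preceq> x \<ominus> y"
    using dense[of "x \<ominus> y"] x y by (auto simp: diff_eq_zero_iff)
  let ?k = "coord p x"
  have kx: "?k \<cdot> p \<preceq> x" and kN: "?k \<le> atom_order p" using p x by (simp_all add: coord_mult_le coord_le)
  have ky: "?k \<cdot> p \<preceq> y" using le[OF p(1)] le_coord_iff[OF p(1) y kN] by simp
  have "p \<preceq> x \<ominus> ?k \<cdot> p"
    using p(2) diff_antimono[OF ky x] p(1) x y by (meson le_trans mult_closed atom_closed diff_closed)
  then have "?k \<cdot> p \<oplus> p \<preceq> x"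
    using plus_mono_left[of p "x \<ominus> ?k \<cdot> p" "?k \<cdot> p"] plus_diff[OF kx] p x by simp
  then have "Suc ?k \<cdot> p \<preceq> x" using p plus_comm[of p "?k \<cdot> p"] by simp
  then have "min (atom_order p) (Suc ?k) \<le> ?k" using p x mult_le_imp_min_le_coord by blast
  then have "?k = atom_order p" using kN by simp
  then have "coord p y = atom_order p" using le[OF p(1)] coord_le[OF p(1) y] by simp
  then have "coord p (\<sim>y) = 0" using p y by (simp add: coord_neg)
  moreover have "1 \<cdot> p \<preceq> \<sim>y"
    using p x y diff_le_neg[of x y] by (simp, meson le_trans neg_closed atom_closed diff_closed)
  then have "min (atom_order p) 1 \<le> coord p (\<sim>y)" using p y mult_le_imp_min_le_coord by blast
  ultimately show False using atom_order_pos[OF p(1)] by simp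
qed

text \<open>The supremum of the prescribed multiples works. That its coordinate at \<open>q\<close>
  is not too large is seen from a single upper bound of all these multiples whose coordinate at
  \<open>q\<close> is exactly \<open>f q\<close>.\<close>

lemma coord_surj:
  assumes f: "\<And>p. mv_atom p \<Longrightarrow> f p \<le> atom_order p"
  shows "\<exists>x\<in>carrier A. \<forall>p. mv_atom p \<longrightarrow> coord p x = f p"
proof -
  let ?S = "{f p \<cdot> p | p. mv_atom p}"
  have S: "?S \<subseteq> carrier A" by auto
  have "coord q (mv_Sup ?S) = f q" if q: "mv_atom q" for q
  proof (rule antisym)
    define e where "e = atom_order q \<cdot> q"
    \<comment> \<open>The element with coordinate \<open>f q\<close> at \<open>q\<close> and nothing
      removed elsewhere: \<open>\<sim>e\<close> has coordinate 0 at \<open>q\<close> and lies above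
      every multiple of every other atom.\<close>
    define u where "u = f q \<cdot> q \<oplus> \<sim>e"
    have e: "e \<in> carrier A" and u: "u \<in> carrier A" using q by (auto simp: e_def u_def)
    have "coord q u = f q"
      using q e f[OF q] by (simp add: u_def coord_plus coord_neg coord_mult)
         (simp add: e_def coord_mult q)
    have "f p \<cdot> p \<preceq> u" if p: "mv_atom p" for p
    proof (cases "p = q")
      case True
      then show ?thesis using q e by (simp add: u_def le_plus1)
    next
      case False
      have "coord q (\<sim>(f p \<cdot> p)) = atom_order q"
        using p q False by (simp add: coord_neg coord_mult_other_atom)
      then have "e \<preceq> \<sim>(f p \<cdot> p)"
        using coord_mult_le[OF q, of "\<sim>(f p \<cdot> p)"] p by (simp add: e_def)
      then have "f p \<cdot> p \<preceq> \<sim>e" using p e by (simp add: neg_le_swap)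
      moreover have "\<sim>e \<preceq> u" using q e by (simp add: u_def le_plus2)
      ultimately show ?thesis using p e u by (meson le_trans neg_closed mult_closed atom_closed)
    qed
    then have "mv_Sup ?S \<preceq> u" using S u by (intro Sup_least) auto
    then have "coord q (mv_Sup ?S) \<cdot> q \<preceq> u"
      using coord_mult_le[OF q, of "mv_Sup ?S"] S u q
      by (meson le_trans mult_closed atom_closed Sup_closed)
    then show "coord q (mv_Sup ?S) \<le> f q"
      using le_coord_iff[OF q u] coord_le[OF q] S \<open>coord q u = f q\<close> by simp
  next
    have "f q \<cdot> q \<preceq> mv_Sup ?S" using q by (intro Sup_upper[OF S]) auto
    then show "f q \<le> coord q (mv_Sup ?S)" using le_coord_iff[OF q _ f[OF q]] S by simp
  qed
  then show ?thesis using S by blast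
qed

section \<open>The isomorphism with a product of finite chains\<close>

lemma iso_product_of_chains:
  assumes "algebraic_lattice (mv_order A)"
  shows "mv_isomorphic A
    (mv_product {p. mv_atom p} (\<lambda>p. mv_chain (Suc (atom_order p))))"
proof -
  let ?X = "{p. mv_atom p}"
  let ?P = "mv_product ?X (\<lambda>p. mv_chain (Suc (atom_order p)))"
  \<comment> \<open>The coordinate at \<open>p\<close> takes \<open>atom_order p + 1\<close> values,
    whence the \<open>Suc\<close> in the chain length; dividing by \<open>atom_order p\<close>
    scales them into the unit interval.\<close>
  define h where "h x = (\<lambda>p\<in>?X. real (coord p x) / real (atom_order p))" for x
  have pos: "\<And>p. mv_atom p \<Longrightarrow> real (atom_order p) > 0" using atom_order_pos by simp
  have inj: "inj_on h (carrier A)"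
  proof (rule inj_onI)
    fix x y assume xy: "x \<in> carrier A" "y \<in> carrier A" "h x = h y"
    have "coord p x = coord p y" if p: "mv_atom p" for p
      using fun_cong[OF xy(3), of p] p pos[OF p] by (simp add: h_def)
    then show "x = y"
      using xy le_if_coord_le[OF atom_exists_below[OF assms]] by (intro le_antisym) auto
  qed
  have "h x \<in> carrier ?P" if "x \<in> carrier A" for x
    using coord_le[OF _ that] by (auto simp: h_def mv_product_def mv_chain_def)
  moreover have "\<exists>x\<in>carrier A. f = h x" if f: "f \<in> carrier ?P" for f
  proof -
    have "\<exists>k. mv_atom p \<longrightarrow> k \<le> atom_order p \<and> f p = real k / real (atom_order p)" for p
      using f by (auto simp: mv_product_def mv_chain_def PiE_iff)
    then obtain k where k: "\<And>p. mv_atom p \<Longrightarrow> k p \<le> atom_order p"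
      "\<And>p. mv_atom p \<Longrightarrow> f p = real (k p) / real (atom_order p)" by metis
    obtain x where "x \<in> carrier A" "\<And>p. mv_atom p \<Longrightarrow> coord p x = k p"
      using coord_surj[of k] k(1) by blast
    moreover have "f \<in> extensional ?X" using f by (auto simp: mv_product_def PiE_iff)
    ultimately show ?thesis
      using k by (intro bexI[of _ x]) (auto simp: h_def extensional_def fun_eq_iff)
  qed
  ultimately have "bij_betw h (carrier A) (carrier ?P)"
    using inj by (auto simp: bij_betw_def)
  moreover have "h (x \<oplus> y) = h x \<oplus>\<^bsub>?P\<^esub> h y" if "x \<in> carrier A" "y \<in> carrier A" for x y
    using that pos
    by (auto simp: h_def mv_product_def mv_chain_def fun_eq_iff coord_plus min_def field_simps
        simp flip: of_nat_add)
  moreover have "h (\<sim>x) = \<sim>\<^bsub>?P\<^esub>(h x)" if "x \<in> carrier A" for x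
    using that pos
    by (auto simp: h_def mv_product_def mv_chain_def fun_eq_iff coord_neg coord_le of_nat_diff
        field_simps)
  moreover have "h \<zero> = \<zero>\<^bsub>?P\<^esub>"
    by (auto simp: h_def mv_product_def mv_chain_def fun_eq_iff coord_zero)
  ultimately show ?thesis unfolding mv_isomorphic_def mv_iso_def by blast
qed

section \<open>Products of finite chains are algebraic\<close>

text \<open>The isomorphism turns the natural order into the coordinatewise order of reals, so
  suprema can be tested against elements with prescribed coordinates.\<close>

lemma algebraic_if_iso_product_of_chains:
  assumes n: "\<And>i. i \<in> X \<Longrightarrow> n i \<ge> 2"
    and iso: "mv_isomorphic A (mv_product X (\<lambda>i. mv_chain (n i)))"
  shows "algebraic_lattice (mv_order A)"
proof -
  let ?P = "mv_product X (\<lambda>i. mv_chain (n i))"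
  obtain h where bij: "bij_betw h (carrier A) (carrier ?P)"
    and h_plus: "\<And>x y. \<lbrakk>x \<in> carrier A; y \<in> carrier A\<rbrakk> \<Longrightarrow> h (x \<oplus> y) = h x \<oplus>\<^bsub>?P\<^esub> h y"
    and h_neg: "\<And>x. x \<in> carrier A \<Longrightarrow> h (\<sim>x) = \<sim>\<^bsub>?P\<^esub>(h x)"
    and h_zero: "h \<zero> = \<zero>\<^bsub>?P\<^esub>"
    using iso unfolding mv_isomorphic_def mv_iso_def by blast
  define C where "C i = carrier (mv_chain (n i))" for i
  have C_iff: "v \<in> C i \<longleftrightarrow> (\<exists>k\<le>n i - 1. v = real k / real (n i - 1))" for v i
    by (auto simp: C_def mv_chain_def)
  have C01: "0 \<in> C i" "1 \<in> C i" if "i \<in> X" for i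
    unfolding C_iff using n[OF that] by (auto intro: exI[of _ 0] exI[of _ "n i - 1"])
  have h_mem: "h x i \<in> C i" if "x \<in> carrier A" "i \<in> X" for x i
    using bij_betwE[OF bij] that by (auto simp: mv_product_def C_def)
  have bounds: "0 \<le> v \<and> v \<le> 1" if "v \<in> C i" for v i
    using that unfolding C_iff by (auto simp: divide_le_eq)
  have le_h: "x \<preceq> y \<longleftrightarrow> (\<forall>i\<in>X. h x i \<le> h y i)" if xy: "x \<in> carrier A" "y \<in> carrier A" for x y
  proof -
    have "x \<preceq> y \<longleftrightarrow> h (\<sim>x \<oplus> y) = h (\<sim>\<zero>)"
      using xy inj_on_eq_iff[OF bij_betw_imp_inj_on[OF bij], of "\<sim>x \<oplus> y" "\<sim>\<zero>"]
      by (simp add: le_iff)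
    also have "\<dots> \<longleftrightarrow> (\<forall>i\<in>X. h x i \<le> h y i)"
      using xy by (auto simp: h_plus h_neg h_zero mv_product_def mv_chain_def fun_eq_iff min_def)
    finally show ?thesis .
  qed
  have ex: "\<exists>x\<in>carrier A. \<forall>i\<in>X. h x i = f i" if "\<And>i. i \<in> X \<Longrightarrow> f i \<in> C i" for f
  proof -
    have "restrict f X \<in> carrier ?P" using that by (auto simp: mv_product_def C_def)
    then obtain x where "x \<in> carrier A" "h x = restrict f X"
      using bij by (metis bij_betw_imp_surj_on imageE)
    then show ?thesis by (intro bexI[of _ x]) simp_all
  qed
  \<comment> \<open>An element supported at \<open>i\<close> is compact because its value
    \<open>v\<close> there has an immediate predecessor \<open>w\<close> in the chain: a set with no
    member reaching \<open>v\<close> at \<open>i\<close> stays below \<open>w\<close> there, and so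
    does its supremum.\<close>
  have spike: "\<exists>c. compact_element (mv_order A) c \<and> h c i = v \<and> (\<forall>j\<in>X. j \<noteq> i \<longrightarrow> h c j = 0)"
    if i: "i \<in> X" and v: "v \<in> C i" and "v \<noteq> 0" for i v
  proof -
    obtain k where k: "k \<le> n i - 1" "v = real k / real (n i - 1)"
      using v unfolding C_iff by blast
    have k0: "k \<noteq> 0" using k \<open>v \<noteq> 0\<close> by auto
    define w where "w = real (k - 1) / real (n i - 1)"
    have w: "w \<in> C i" unfolding C_iff w_def using k(1) by (intro exI[of _ "k - 1"]) auto
    have wv: "w < v" using k k0 n[OF i] by (auto simp: w_def intro!: divide_strict_right_mono)
    have gap: "t \<le> w" if t: "t \<in> C i" "\<not> v \<le> t" for t
    proof -
      obtain l where l: "t = real l / real (n i - 1)" using t(1) unfolding C_iff by blast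
      have "l < k"
      proof (rule ccontr)
        assume "\<not> l < k"
        then have "v \<le> t" unfolding k l by (intro divide_right_mono) auto
        with t(2) show False by simp
      qed
      then show ?thesis unfolding l w_def by (intro divide_right_mono) auto
    qed
    have cC: "(if j = i then v else 0) \<in> C j" if "j \<in> X" for j
      using v C01[OF that] by simp
    obtain c where c: "c \<in> carrier A" "\<And>j. j \<in> X \<Longrightarrow> h c j = (if j = i then v else 0)"
      using ex[of "\<lambda>j. if j = i then v else 0", OF cC] by blast
    have uC: "(if j = i then w else 1) \<in> C j" if "j \<in> X" for j
      using w C01[OF that] by simp
    \<comment> \<open>\<open>u\<close> is the largest element whose value at \<open>i\<close> is at
      most \<open>w\<close>; it bounds \<open>S\<close> when no single member of \<open>S\<close>
      lies above \<open>c\<close>.\<close>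
    obtain u where u: "u \<in> carrier A" "\<And>j. j \<in> X \<Longrightarrow> h u j = (if j = i then w else 1)"
      using ex[of "\<lambda>j. if j = i then w else 1", OF uC] by blast
    have "\<exists>F. finite F \<and> F \<subseteq> S \<and> c \<preceq> mv_Sup F" if S: "S \<subseteq> carrier A" "c \<preceq> mv_Sup S" for S
    proof (cases "\<exists>s\<in>S. v \<le> h s i")
      case True
      then obtain s where s: "s \<in> S" "s \<in> carrier A" "v \<le> h s i" using S by blast
      have "h c j \<le> h s j" if "j \<in> X" for j
        using c(2)[OF that] s(3) bounds[OF h_mem[OF s(2) that]] by auto
      then have "c \<preceq> s" using le_h[OF c(1) s(2)] by blast
      moreover have "s \<preceq> mv_Sup {s}" using s by (intro Sup_upper) auto
      ultimately have "c \<preceq> mv_Sup {s}"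
        using c s le_trans[of c s "mv_Sup {s}"] Sup_closed[of "{s}"] by simp
      then show ?thesis using s by (intro exI[of _ "{s}"]) auto
    next
      case False
      have "s \<preceq> u" if "s \<in> S" for s
      proof -
        have s: "s \<in> carrier A" using that S(1) by blast
        have "h s j \<le> h u j" if j: "j \<in> X" for j
        proof (cases "j = i")
          case True
          then show ?thesis using gap[OF h_mem[OF s i]] False \<open>s \<in> S\<close> u(2)[OF i] by auto
        next
          case False
          then show ?thesis using bounds[OF h_mem[OF s j]] u(2)[OF j] by simp
        qed
        then show ?thesis using le_h[OF s u(1)] by blast
      qed
      then have "mv_Sup S \<preceq> u" using S(1) u(1) by (intro Sup_least)
      then have "c \<preceq> u" by (rule le_trans[OF S(2) _ c(1) Sup_closed[OF S(1)] u(1)])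
      then have "v \<le> w" using le_h[OF c(1) u(1)] c(2)[OF i] u(2)[OF i] i by auto
      with wv show ?thesis by simp
    qed
    then have "compact_element (mv_order A) c" using c(1) by (simp add: compact_element_def)
    then show ?thesis using c(2) i by auto
  qed
  have "a = mv_Sup {c. compact_element (mv_order A) c \<and> c \<preceq> a}" (is "a = mv_Sup ?C")
    if a: "a \<in> carrier A" for a
  proof (rule le_antisym)
    have C: "?C \<subseteq> carrier A" by (auto simp: compact_element_def)
    show "mv_Sup ?C \<in> carrier A" using C by (rule Sup_closed)
    show "mv_Sup ?C \<preceq> a" using C a by (rule Sup_least) blast
    have "h a i \<le> h (mv_Sup ?C) i" if i: "i \<in> X" for i
    proof (cases "h a i = 0")
      case True
      then show ?thesis using bounds h_mem[OF Sup_closed[OF C] i] by simp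
    next
      case False
      \<comment> \<open>The spike that agrees with \<open>a\<close> at \<open>i\<close> is a compact
        element below \<open>a\<close>, so the supremum reaches \<open>h a i\<close> at
        \<open>i\<close>.\<close>
      then obtain c where c: "compact_element (mv_order A) c" "h c i = h a i"
        and c0: "\<forall>j\<in>X. j \<noteq> i \<longrightarrow> h c j = 0"
        using spike[OF i h_mem[OF a i]] by blast
      have cA: "c \<in> carrier A" using c(1) by (simp add: compact_element_def)
      have "h c j \<le> h a j" if "j \<in> X" for j
        using c(2) c0 that bounds[OF h_mem[OF a that]] by (cases "j = i") auto
      then have "c \<preceq> a" using le_h[OF cA a] by blast
      then have "c \<preceq> mv_Sup ?C" using c(1) by (intro Sup_upper[OF C]) blast
      then have "h c i \<le> h (mv_Sup ?C) i" using le_h[OF cA Sup_closed[OF C]] i by blast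
      then show ?thesis using c(2) by simp
    qed
    then show "a \<preceq> mv_Sup ?C" using le_h[OF a Sup_closed[OF C]] by blast
  qed (rule a)
  then show ?thesis unfolding algebraic_lattice_def carrier_mv_order by blast
qed

end

theorem theorem2p8:
  fixes A :: "('a, 'm) mv_scheme"
  assumes "mv_algebra A"
    and "complete_lattice (mv_order A)"
  shows "(algebraic_lattice (mv_order A) \<longleftrightarrow>
           (\<exists>(X :: 'a set) (n :: 'a \<Rightarrow> nat). (\<forall>x\<in>X. n x \<ge> 2) \<and>
              mv_isomorphic A (mv_product X (\<lambda>x. mv_chain (n x)))))
       \<and> (\<forall>(X :: 'i set) (n :: 'i \<Rightarrow> nat). (\<forall>x\<in>X. n x \<ge> 2) \<and>
              mv_isomorphic A (mv_product X (\<lambda>x. mv_chain (n x)))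
              \<longrightarrow> algebraic_lattice (mv_order A))"
proof -
  interpret complete_mv A
    using assms by (intro complete_mv.intro)
  have "\<exists>(X :: 'a set) n. (\<forall>x\<in>X. n x \<ge> 2) \<and>
      mv_isomorphic A (mv_product X (\<lambda>x. mv_chain (n x)))"
    if "algebraic_lattice (mv_order A)"
  proof -
    have "\<forall>p\<in>{p. mv_atom p}. Suc (atom_order p) \<ge> 2"
      using atom_order_pos by (auto simp: Suc_le_eq numeral_2_eq_2)
    with iso_product_of_chains[OF that] show ?thesis
      by (intro exI[of _ "{p. mv_atom p}"] exI[of _ "\<lambda>p. Suc (atom_order p)"] conjI)
  qed
  \<comment> \<open>The converse is applied at two index types: subsets of \<open>'a\<close>, which
    suffice for the atoms, and subsets of the arbitrary type \<open>'i\<close>.\<close>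
  then show ?thesis
    by (intro conjI iffI allI impI; (elim exE conjE)?)
       (erule algebraic_if_iso_product_of_chains[rotated], blast | blast)+
qed

end
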